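(* Let $n \geq 1$ be an integer, and let $\alpha > 0$ and $\beta > n/2$ be real numbers. Then there exists a constant $c_{\alpha,\beta,n} > 0$, depending only on $\alpha$, $\beta$ and $n$, such that for all $u \in L^1(\mathbb{R}^n)$ $$ \big\| |\xi|^{\beta} \cdot \widehat{u}\big\|_{L^{\infty}(\mathbb{R}^n)}^{\alpha} \cdot \big\| |x|^{\alpha} \cdot u \big\|_{L^1(\mathbb{R}^n)}^{\beta} \geq c_{\alpha,\beta,n}\, \|u\|_{L^1(\mathbb{R}^n)}^{\alpha+\beta}.$$
   Context: The Fourier transform is $\widehat{u}(\xi) = \int_{\mathbb{R}^n} u(x) e^{-2\pi i \langle \xi, x\rangle}\,dx$. The norms $\| |\xi|^{\beta}\widehat{u}\|_{L^\infty}$ and $\| |x|^\alpha u\|_{L^1}$ are allowed to take the value $+\infty$. (For $u \neq 0$ both are strictly positive, so the product on the left is well defined in $(0,\infty]$; for $u=0$ both sides are $0$.) *)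

theory Defs
  imports "HOL-Analysis.Analysis" "HOL-Probability.Essential_Supremum"
begin

definition fourier :: "(real ^ 'n \<Rightarrow> complex) \<Rightarrow> real ^ 'n \<Rightarrow> complex" where
  "fourier u \<xi> = (LINT x|lebesgue. u x * exp (- 2 * of_real pi * \<i> * of_real (\<xi> \<bullet> x)))"

(* Both norms take values in [0,\<infinity>]; they are applied only to measurable functions. *)

definition L1_norm :: "(real ^ 'n \<Rightarrow> complex) \<Rightarrow> ennreal" where
  "L1_norm f = (\<integral>\<^sup>+ x. ennreal (norm (f x)) \<partial>lebesgue)"

definition Linf_norm :: "(real ^ 'n \<Rightarrow> complex) \<Rightarrow> ennreal" where
  "Linf_norm f = esssup lebesgue (\<lambda>x. ennreal (norm (f x)))"

(* Powers on [0,\<infinity>] with a positive exponent: \<infinity> to the power p is \<infinity> and 0 to the power p is 0.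
   Not intended for p \<le> 0. *)

definition ennreal_powr :: "ennreal \<Rightarrow> real \<Rightarrow> ennreal" where
  "ennreal_powr t p = (if t = \<infinity> then \<infinity> else ennreal (enn2real t powr p))"

end

theory Submission
  imports Defs "HOL-Probability.Characteristic_Functions"
begin

text \<open>
The inequality expresses that an integrable function \<open>u\<close> whose mass sits near the origin cannot have
a transform that is small at all frequencies away from the origin. Write \<open>M\<close> for the \<open>L\<^sup>1\<close> norm
of \<open>u\<close>, \<open>A\<close> for the weighted supremum of its transform, \<open>B\<close> for its weighted \<open>L\<^sup>1\<close> norm, and
\<open>n\<close> for the dimension.

By Chebyshev's inequality at least half of the mass of \<open>u\<close> lies in the ball of radius
\<open>R = (2 * B / M) powr (1 / \<alpha>)\<close> (\<open>concentration_radius\<close>). By Cauchy-Schwarz and Plancherel the square of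
that mass is at most a constant times \<open>R ^ n\<close> times the square integral of the transform
(\<open>local_L1_le_fourier_L2\<close>). Bounding the transform by \<open>M\<close> at frequencies below \<open>r\<close> and by
\<open>A * norm \<xi> powr (- \<beta>)\<close> above, where \<open>\<beta> > n / 2\<close> makes the square integrable, gives
\<open>M\<^sup>2 \<le> K * R ^ n * (r ^ n * M\<^sup>2 + A\<^sup>2 * r powr (n - 2 * \<beta>))\<close> for a constant \<open>K\<close>
(\<open>fourier_L2_le\<close>). For \<open>r\<close> a small multiple of \<open>1 / R\<close> the first term is absorbed on the left, leaving
\<open>M \<le> D * A * R powr \<beta>\<close> (\<open>L1_le_of_concentration\<close>); raising this to the power \<open>\<alpha>\<close> and inserting the
value of \<open>R\<close> is the claim.

Only one consequence of Plancherel's theorem is used, and it is proved for integrable functions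
by duality: a Parseval identity weighted by a Gaussian holds by Fubini's theorem
(\<open>gauss_weighted_Parseval\<close>); for continuous bounded test functions of compact support the Gaussian can
be removed (\<open>pairing_le_fourier_L2\<close>); and such functions approximate the sign of \<open>u\<close> on a ball. The same
estimate shows that a function with vanishing transform vanishes almost everywhere, which handles
the case \<open>A = 0\<close>, \<open>B = \<infinity>\<close>.
\<close>

section \<open>Gaussian densities and their Fourier transforms\<close>

definition std_gauss :: "'a::euclidean_space \<Rightarrow> real" where
  "std_gauss x = (\<Prod>b\<in>Basis. std_normal_density (x \<bullet> b))"

text \<open>The product form is what Fubini's theorem consumes, the radial form below is what rescaling needs.\<close>

lemma std_gauss_eq:
  "std_gauss (x::'a::euclidean_space) = exp (- (norm x)\<^sup>2 / 2) / sqrt (2 * pi) ^ DIM('a)"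
proof -
  have "(norm x)\<^sup>2 = (\<Sum>b\<in>Basis. (x \<bullet> b)\<^sup>2)"
    by (simp only: norm_eq_sqrt_inner euclidean_inner[of x x] power2_eq_square[symmetric])
       (simp add: sum_nonneg)
  then show ?thesis
    by (simp add: std_gauss_def std_normal_density_def prod_dividef prod.distrib
        exp_sum[symmetric] sum_negf sum_divide_distrib power_one_over)
qed

lemma std_gauss_nonneg: "0 \<le> std_gauss x"
  by (simp add: std_gauss_eq)

lemma borel_measurable_std_gauss [measurable]: "std_gauss \<in> borel_measurable borel"
  unfolding std_gauss_eq [abs_def] by measurable

lemma lborel_integral_prod:
  fixes f :: "'a::euclidean_space \<Rightarrow> real \<Rightarrow> complex"
  assumes "\<And>b. b \<in> Basis \<Longrightarrow> integrable lborel (f b)"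
  shows "integrable lborel (\<lambda>x::'a. \<Prod>b\<in>Basis. f b (x \<bullet> b))"
    and "(\<integral>x. (\<Prod>b\<in>Basis. f b (x \<bullet> b)) \<partial>lborel) = (\<Prod>b\<in>Basis. \<integral>x. f b x \<partial>lborel)"
proof -
  interpret product_sigma_finite "\<lambda>_::'a. lborel :: real measure" ..
  have [measurable]: "f b \<in> borel_measurable borel" if "b \<in> Basis" for b
    using borel_measurable_integrable[OF assms[OF that]] by simp
  show "integrable lborel (\<lambda>x::'a. \<Prod>b\<in>Basis. f b (x \<bullet> b))"
    by (subst lborel_eq, subst integrable_distr_eq)
       (auto intro!: product_integrable_prod assms)
  show "(\<integral>x. (\<Prod>b\<in>Basis. f b (x \<bullet> b)) \<partial>lborel) = (\<Prod>b\<in>Basis. \<integral>x. f b x \<partial>lborel)"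
    by (subst lborel_eq, subst integral_distr)
       (auto simp: product_integral_prod assms)
qed

lemma std_normal_iexp:
  "integrable lborel (\<lambda>x. std_normal_density x * iexp (t * x))"
  "(\<integral>x. std_normal_density x * iexp (t * x) \<partial>lborel) = complex_of_real (exp (- t\<^sup>2 / 2))"
proof -
  show "integrable lborel (\<lambda>x. std_normal_density x * iexp (t * x))"
    by (rule Bochner_Integration.integrable_bound[OF integrable_normal_density[of 1 0]])
       (auto simp: norm_mult)
  have "(\<integral>x. std_normal_density x * iexp (t * x) \<partial>lborel) = char std_normal_distribution t"
    unfolding char_def by (subst integral_density) (auto simp: scaleR_conv_of_real)
  also have "\<dots> = complex_of_real (exp (- t\<^sup>2 / 2))"
    by (simp add: char_std_normal_distribution)
  finally show "(\<integral>x. std_normal_density x * iexp (t * x) \<partial>lborel) = complex_of_real (exp (- t\<^sup>2 / 2))" .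
qed

text \<open>Both the density and the character are products over the coordinates, so the integral factors into
one-dimensional characteristic functions of the standard normal law.\<close>

lemma std_gauss_iexp:
  fixes \<xi> :: "'a::euclidean_space"
  shows "(\<integral>x. std_gauss x * iexp (\<xi> \<bullet> x) \<partial>lborel) = complex_of_real (exp (- (norm \<xi>)\<^sup>2 / 2))"
    and integrable_std_gauss_iexp: "integrable lborel (\<lambda>x. std_gauss x * iexp (\<xi> \<bullet> x))"
proof -
  have *: "std_gauss x * iexp (\<xi> \<bullet> x) =
      (\<Prod>b\<in>Basis. std_normal_density (x \<bullet> b) * iexp ((\<xi> \<bullet> b) * (x \<bullet> b)))" for x :: 'a
    by (simp add: std_gauss_def euclidean_inner[of \<xi> x] prod.distrib sum_distrib_left exp_sum)
  have "(norm \<xi>)\<^sup>2 = (\<Sum>b\<in>Basis. (\<xi> \<bullet> b)\<^sup>2)"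
    by (simp only: norm_eq_sqrt_inner euclidean_inner[of \<xi> \<xi>] power2_eq_square[symmetric])
       (simp add: sum_nonneg)
  then have **: "(\<Prod>b\<in>Basis. complex_of_real (exp (- (\<xi> \<bullet> b)\<^sup>2 / 2))) =
      complex_of_real (exp (- (norm \<xi>)\<^sup>2 / 2))"
    by (simp add: exp_sum[symmetric] sum_negf sum_divide_distrib flip: of_real_prod)
  show "(\<integral>x. std_gauss x * iexp (\<xi> \<bullet> x) \<partial>lborel) = complex_of_real (exp (- (norm \<xi>)\<^sup>2 / 2))"
    unfolding * by (subst lborel_integral_prod(2)[OF std_normal_iexp(1)])
      (simp only: std_normal_iexp(2) **)
  show "integrable lborel (\<lambda>x. std_gauss x * iexp (\<xi> \<bullet> x))"
    unfolding * by (rule lborel_integral_prod(1)[OF std_normal_iexp(1)])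
qed

lemma integrable_std_gauss: "integrable lborel (std_gauss :: 'a::euclidean_space \<Rightarrow> real)"
  using integrable_norm[OF integrable_std_gauss_iexp[of "0::'a"]]
  by (simp add: std_gauss_nonneg)

lemma integral_std_gauss: "integral\<^sup>L lborel (std_gauss :: 'a::euclidean_space \<Rightarrow> real) = 1"
  using std_gauss_iexp[of "0::'a"] by (simp flip: of_real_eq_iff)

lemma lborel_integral_affine:
  fixes f :: "'a::euclidean_space \<Rightarrow> complex"
  assumes [measurable]: "f \<in> borel_measurable borel" and c: "c \<noteq> 0"
  shows "(\<integral>x. f x \<partial>lborel) = complex_of_real (\<bar>c\<bar> ^ DIM('a)) * (\<integral>x. f (t + c *\<^sub>R x) \<partial>lborel)"
    and "integrable lborel (\<lambda>x. f (t + c *\<^sub>R x)) \<Longrightarrow> integrable lborel f"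
proof -
  have "(\<integral>x. f x \<partial>lborel) = (\<integral>x. f x \<partial>density (distr lborel borel (\<lambda>x. t + c *\<^sub>R x)) (\<lambda>_. \<bar>c\<bar>^DIM('a)))"
    using lborel_affine[OF c, of t] by simp
  also have "\<dots> = complex_of_real (\<bar>c\<bar> ^ DIM('a)) * (\<integral>x. f (t + c *\<^sub>R x) \<partial>lborel)"
    by (subst integral_density) (auto simp: integral_distr scaleR_conv_of_real)
  finally show "(\<integral>x. f x \<partial>lborel) = complex_of_real (\<bar>c\<bar> ^ DIM('a)) * (\<integral>x. f (t + c *\<^sub>R x) \<partial>lborel)" by simp
  have "integrable lborel f \<longleftrightarrow> integrable (density (distr lborel borel (\<lambda>x. t + c *\<^sub>R x)) (\<lambda>_. \<bar>c\<bar>^DIM('a))) f"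
    using lborel_affine[OF c, of t] by simp
  also have "\<dots> \<longleftrightarrow> integrable lborel (\<lambda>x. \<bar>c\<bar>^DIM('a) *\<^sub>R f (t + c *\<^sub>R x))"
    by (subst integrable_density) (auto simp: integrable_distr_eq)
  finally show "integrable lborel f" if "integrable lborel (\<lambda>x. f (t + c *\<^sub>R x))"
    using that by simp
qed

text \<open>The frequency-side Gaussian of width \<open>1 / t\<close>, normalised so that its transform is the
probability density of \<open>t *\<^sub>R Z\<close> for a standard Gaussian vector \<open>Z\<close>.
As \<open>t\<close> tends to \<open>0\<close> the weight tends to \<open>1\<close> while that density concentrates at the origin.\<close>

definition gauss_weight :: "real \<Rightarrow> 'a::euclidean_space \<Rightarrow> real" where
  "gauss_weight t \<xi> = exp (- 2 * pi\<^sup>2 * t\<^sup>2 * (norm \<xi>)\<^sup>2)"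

lemma gauss_weight_scale:
  assumes "t > 0"
  shows "gauss_weight t (\<xi>::'a::euclidean_space) = sqrt (2 * pi) ^ DIM('a) * std_gauss ((2 * pi * t) *\<^sub>R \<xi>)"
  using assms by (simp add: gauss_weight_def std_gauss_eq power_mult_distrib)

lemma borel_measurable_gauss_weight [measurable]: "gauss_weight t \<in> borel_measurable borel"
  unfolding gauss_weight_def [abs_def] by measurable

lemma gauss_weight_bounds: "0 \<le> gauss_weight t \<xi>" "gauss_weight t \<xi> \<le> 1"
  by (auto simp: gauss_weight_def)

text \<open>The substitution \<open>\<eta> = 2 \<pi> t \<xi>\<close> turns the weight into a multiple of the standard density,
whose transform is known.\<close>

lemma gauss_weight_transform:
  fixes x :: "'a::euclidean_space"
  assumes t: "t > 0"
  shows "integrable lborel (\<lambda>\<xi>. gauss_weight t \<xi> * iexp (2 * pi * (x \<bullet> \<xi>)))" (is ?I)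
    and "(\<integral>\<xi>. gauss_weight t \<xi> * iexp (2 * pi * (x \<bullet> \<xi>)) \<partial>lborel) =
           complex_of_real (std_gauss (x /\<^sub>R t) / t ^ DIM('a))" (is ?E)
proof -
  define c where "c = 1 / (2 * pi * t)"
  have c: "c > 0" "c * (2 * pi) = 1 / t" "2 * pi * t * c = 1" using t by (auto simp: c_def)
  have *: "gauss_weight t (0 + c *\<^sub>R \<xi>) * iexp (2 * pi * (x \<bullet> (0 + c *\<^sub>R \<xi>))) =
     complex_of_real (sqrt (2 * pi) ^ DIM('a)) * (std_gauss \<xi> * iexp ((x /\<^sub>R t) \<bullet> \<xi>))" for \<xi> :: 'a
  proof -
    have "2 * pi * (x \<bullet> (0 + c *\<^sub>R \<xi>)) = (x /\<^sub>R t) \<bullet> \<xi>"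
    proof -
      have "2 * pi * (x \<bullet> (0 + c *\<^sub>R \<xi>)) = (c * (2 * pi)) * (x \<bullet> \<xi>)" by simp
      also have "\<dots> = (x /\<^sub>R t) \<bullet> \<xi>" unfolding c(2) by (simp add: divide_inverse)
      finally show ?thesis .
    qed
    moreover have "gauss_weight t (0 + c *\<^sub>R \<xi>) = sqrt (2 * pi) ^ DIM('a) * std_gauss \<xi>"
      unfolding gauss_weight_scale[OF t] add_0 scaleR_scaleR c(3) by simp
    ultimately show ?thesis by (simp only: of_real_mult mult.assoc)
  qed
  have m: "(\<lambda>\<xi>. gauss_weight t \<xi> * iexp (2 * pi * (x \<bullet> \<xi>))) \<in> borel_measurable borel"
    by measurable
  show ?I
    by (rule lborel_integral_affine(2)[OF m less_imp_neq[OF c(1), symmetric], of 0], unfold *)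
       (intro integrable_mult_right integrable_std_gauss_iexp)
  have "(\<integral>\<xi>. gauss_weight t \<xi> * iexp (2 * pi * (x \<bullet> \<xi>)) \<partial>lborel) =
      complex_of_real (\<bar>c\<bar> ^ DIM('a)) * (complex_of_real (sqrt (2 * pi) ^ DIM('a)) * complex_of_real (exp (- (norm (x /\<^sub>R t))\<^sup>2 / 2)))"
    unfolding lborel_integral_affine(1)[OF m less_imp_neq[OF c(1), symmetric], of 0] * integral_mult_right_zero std_gauss_iexp ..
  also have "\<dots> = complex_of_real ((c * sqrt (2 * pi) * sqrt (2 * pi)) ^ DIM('a) * std_gauss (x /\<^sub>R t))"
    using c(1) by (simp add: std_gauss_eq power_mult_distrib)
  also have "c * sqrt (2 * pi) * sqrt (2 * pi) = 1 / t"
    using c(2) by (simp add: mult.assoc)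
  finally show ?E by (simp add: power_one_over)
qed

section \<open>A Parseval identity with Gaussian weight\<close>

text \<open>The integral that defines \<open>fourier\<close>, taken against Lebesgue measure on Borel sets. The arguments below integrate expressions such as
\<open>b (x - t *\<^sub>R z)\<close> over products, and these are jointly measurable when \<open>b\<close> is Borel; for a Borel
representative of a Lebesgue integrable function the transform agrees with \<open>fourier\<close>.\<close>

definition lborel_fourier :: "('a::euclidean_space \<Rightarrow> complex) \<Rightarrow> 'a \<Rightarrow> complex" where
  "lborel_fourier u \<xi> = (LINT x|lborel. u x * exp (- 2 * of_real pi * \<i> * of_real (\<xi> \<bullet> x)))"

lemma borel_measurable_cnj [measurable]: "cnj \<in> borel_measurable borel"
  by (intro borel_measurable_continuous_onI continuous_intros)

lemma integrable_pair_mult: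
  fixes f :: "'a::euclidean_space \<Rightarrow> complex" and g :: "'b::euclidean_space \<Rightarrow> complex"
  assumes f: "integrable lborel f" and g: "integrable lborel g"
  shows "integrable (lborel \<Otimes>\<^sub>M lborel) (\<lambda>(x, y). f x * g y)"
proof -
  have [measurable]: "f \<in> borel_measurable borel" "g \<in> borel_measurable borel"
    using f g by auto
  show ?thesis
  proof (rule lborel_pair.Fubini_integrable)
    show "integrable lborel (\<lambda>x. \<integral>y. norm (case (x, y) of (x, y) \<Rightarrow> f x * g y) \<partial>lborel)"
      using f by (simp add: norm_mult)
  qed (use g in auto)
qed

lemma borel_measurable_lborel_fourier [measurable]:
  assumes [measurable]: "u \<in> borel_measurable borel"
  shows "lborel_fourier u \<in> borel_measurable borel"
  unfolding lborel_fourier_def [abs_def] by measurable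

lemma integrable_mult_bounded:
  fixes f g :: "'a::euclidean_space \<Rightarrow> complex"
  assumes f: "integrable lborel f" and g [measurable]: "g \<in> borel_measurable borel"
    and b: "\<And>x. norm (g x) \<le> B"
  shows "integrable lborel (\<lambda>x. f x * g x)"
proof (rule Bochner_Integration.integrable_bound)
  show "integrable lborel (\<lambda>x. B *\<^sub>R f x)" using f by auto
  show "(\<lambda>x. f x * g x) \<in> borel_measurable lborel" using f by auto
  have "norm (f x * g x) \<le> norm (B *\<^sub>R f x)" for x
    using mult_left_mono[OF b[of x] norm_ge_zero[of "f x"]] order_trans[OF norm_ge_zero b[of x]]
    by (simp add: norm_mult mult.commute)
  then show "AE x in lborel. norm (f x * g x) \<le> norm (B *\<^sub>R f x)" by simp
qed

lemma norm_lborel_fourier_le: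
  assumes "integrable lborel u"
  shows "norm (lborel_fourier u \<xi>) \<le> (\<integral>x. norm (u x) \<partial>lborel)"
proof -
  have *: "norm (exp (- 2 * of_real pi * \<i> * complex_of_real r)) = 1" for r
    by simp
  have "norm (lborel_fourier u \<xi>) \<le> (\<integral>x. norm (u x * exp (- 2 * of_real pi * \<i> * of_real (\<xi> \<bullet> x))) \<partial>lborel)"
    unfolding lborel_fourier_def by (rule integral_norm_bound)
  then show ?thesis by (simp only: norm_mult *  mult_1_right)
qed

lemma integrable_gauss_weight:
  assumes t: "t > 0"
  shows "integrable lborel (\<lambda>\<xi>::'a::euclidean_space. complex_of_real (gauss_weight t \<xi>))"
  using gauss_weight_transform(1)[OF t, of "0::'a"] by simp

text \<open>The Gaussian weight makes the triple integral over \<open>\<xi>\<close>, \<open>x\<close> and \<open>y\<close> absolutely convergent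
for merely integrable functions, so the integral over \<open>\<xi>\<close> may be carried out first. It yields the
Gaussian density of width \<open>t\<close> at \<open>x - y\<close>, and the substitution \<open>y = x - t z\<close> writes the result as a
smoothing of \<open>b\<close> that is visibly an average of its values.\<close>

lemma gauss_weighted_Parseval:
  fixes a b :: "'a::euclidean_space \<Rightarrow> complex"
  assumes a: "integrable lborel a" and b: "integrable lborel b" and t: "t > 0"
  shows "(\<integral>\<xi>. lborel_fourier a \<xi> * cnj (lborel_fourier b \<xi>) * gauss_weight t \<xi> \<partial>lborel) =
         (\<integral>x. a x * (\<integral>z. cnj (b (x - t *\<^sub>R z)) * std_gauss z \<partial>lborel) \<partial>lborel)"
proof -
  have [measurable]: "a \<in> borel_measurable borel" "b \<in> borel_measurable borel"
    using a b by auto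
  define e where "e \<xi> x = exp (- 2 * of_real pi * \<i> * of_real (\<xi> \<bullet> x))" for \<xi> x :: 'a
  have e_norm: "norm (e \<xi> x) = 1" for \<xi> x by (simp add: e_def)
  have e_cnj: "e \<xi> x * cnj (e \<xi> y) = iexp (2 * pi * ((y - x) \<bullet> \<xi>))" for \<xi> x y
    by (simp add: e_def exp_cnj exp_add[symmetric] algebra_simps inner_commute)
  have em [measurable]: "\<And>f g. f \<in> borel_measurable M \<Longrightarrow> g \<in> borel_measurable M \<Longrightarrow> (\<lambda>x. e (f x) (g x)) \<in> borel_measurable M" for M :: "'m measure"
    by (auto simp: e_def)
  define ab where "ab = (\<lambda>(x, y). a x * cnj (b y))"
  have ab: "integrable (lborel \<Otimes>\<^sub>M lborel) ab"
    unfolding ab_def using a b by (intro integrable_pair_mult) auto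
  have ab': "integrable lborel ab" using ab by (simp add: lborel_prod)
  have [measurable]: "ab \<in> borel_measurable borel" using ab' by auto
  define G where "G \<xi> p = ab p * (gauss_weight t \<xi> * iexp (2 * pi * ((snd p - fst p) \<bullet> \<xi>)))"
    for \<xi> and p :: "'a \<times> 'a"
  \<comment> \<open>the product of the two transforms, as an integral over pairs\<close>
  have 1: "lborel_fourier a \<xi> * cnj (lborel_fourier b \<xi>) * gauss_weight t \<xi> = (\<integral>p. G \<xi> p \<partial>lborel)" for \<xi>
  proof -
    have ia: "integrable lborel (\<lambda>x. a x * e \<xi> x)"
      by (rule integrable_mult_bounded[OF a, where B=1]) (auto simp: e_norm)
    have ib: "integrable lborel (\<lambda>x. b x * e \<xi> x)"
      by (rule integrable_mult_bounded[OF b, where B=1]) (auto simp: e_norm)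
    have ip: "integrable (lborel \<Otimes>\<^sub>M lborel) (\<lambda>(x, y). (a x * e \<xi> x) * cnj (b y * e \<xi> y))"
      by (intro integrable_pair_mult ia Bochner_Integration.integrable_cnj ib)
    have "lborel_fourier a \<xi> * cnj (lborel_fourier b \<xi>) =
        (\<integral>x. a x * e \<xi> x \<partial>lborel) * (\<integral>y. cnj (b y * e \<xi> y) \<partial>lborel)"
      unfolding lborel_fourier_def e_def[symmetric] Bochner_Integration.integral_cnj ..
    also have "\<dots> = (\<integral>x. \<integral>y. (a x * e \<xi> x) * cnj (b y * e \<xi> y) \<partial>lborel \<partial>lborel)"
      by simp
    also have "\<dots> = (\<integral>p. (case p of (x, y) \<Rightarrow> (a x * e \<xi> x) * cnj (b y * e \<xi> y)) \<partial>lborel)"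
      using lborel_pair.integral_fst[OF ip] by (simp add: lborel_prod)
    also have "\<dots> * gauss_weight t \<xi> = (\<integral>p. (case p of (x, y) \<Rightarrow> (a x * e \<xi> x) * cnj (b y * e \<xi> y)) * gauss_weight t \<xi> \<partial>lborel)"
      by simp
    also have "\<dots> = (\<integral>p. G \<xi> p \<partial>lborel)"
    proof (intro Bochner_Integration.integral_cong refl, clarify)
      fix x y
      show "a x * e \<xi> x * cnj (b y * e \<xi> y) * gauss_weight t \<xi> = G \<xi> (x, y)"
        unfolding G_def ab_def fst_conv snd_conv prod.case e_cnj[symmetric] complex_cnj_mult
        by (simp only: mult_ac)
    qed
    finally show ?thesis .
  qed
  have iG: "integrable (lborel \<Otimes>\<^sub>M lborel) (case_prod G)"
  proof -
    have i: "integrable lborel (\<lambda>(\<xi>, p). gauss_weight t \<xi> * ab p)"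
      using integrable_pair_mult[OF integrable_gauss_weight[OF t] ab'] by (simp add: lborel_prod)
    have "integrable lborel (\<lambda>q. (case q of (\<xi>, p) \<Rightarrow> gauss_weight t \<xi> * ab p) *
       (case q of (\<xi>, p) \<Rightarrow> iexp (2 * pi * ((snd p - fst p) \<bullet> \<xi>))))"
      by (rule integrable_mult_bounded[OF i, where B=1])
         (auto simp: split_beta intro!: borel_measurable_continuous_onI continuous_intros)
    also have "(\<lambda>q. (case q of (\<xi>, p) \<Rightarrow> gauss_weight t \<xi> * ab p) *
       (case q of (\<xi>, p) \<Rightarrow> iexp (2 * pi * ((snd p - fst p) \<bullet> \<xi>)))) = case_prod G"
      by (auto simp: G_def fun_eq_iff)
    finally show ?thesis by (simp add: lborel_prod)
  qed
  define P where "P x = complex_of_real (std_gauss (x /\<^sub>R t) / t ^ DIM('a))" for x :: 'a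
  have [measurable]: "P \<in> borel_measurable borel" unfolding P_def [abs_def] by measurable
  have P_le: "norm (P x) \<le> 1 / sqrt (2 * pi) ^ DIM('a) / t ^ DIM('a)" for x
    unfolding P_def norm_of_real using t by (simp add: std_gauss_eq divide_right_mono)
  have 2: "(\<integral>\<xi>. G \<xi> p \<partial>lborel) = ab p * P (snd p - fst p)" for p
    unfolding G_def P_def integral_mult_right_zero gauss_weight_transform(2)[OF t] ..
  have iP: "integrable lborel (\<lambda>p. ab p * P (snd p - fst p))"
  proof (rule integrable_mult_bounded[OF ab' _ P_le])
    have "(\<lambda>p::'a \<times> 'a. snd p - fst p) \<in> borel_measurable borel"
      by (intro borel_measurable_continuous_onI continuous_intros)
    then show "(\<lambda>p. P (snd p - fst p)) \<in> borel_measurable borel"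
      by (rule measurable_compose) measurable
  qed
  have "(\<integral>\<xi>. lborel_fourier a \<xi> * cnj (lborel_fourier b \<xi>) * gauss_weight t \<xi> \<partial>lborel) =
      (\<integral>\<xi>. \<integral>p. G \<xi> p \<partial>lborel \<partial>lborel)"
    unfolding 1 ..
  also have "\<dots> = (\<integral>p. ab p * P (snd p - fst p) \<partial>lborel)"
    using lborel_pair.Fubini_integral[OF iG] unfolding 2 by simp
  also have "\<dots> = (\<integral>x. \<integral>y. a x * cnj (b y) * P (y - x) \<partial>lborel \<partial>lborel)"
    using lborel_pair.integral_fst'[of "\<lambda>p. ab p * P (snd p - fst p)"] iP
    by (simp add: lborel_prod ab_def)
  also have "\<dots> = (\<integral>x. a x * (\<integral>z. cnj (b (x - t *\<^sub>R z)) * std_gauss z \<partial>lborel) \<partial>lborel)"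
  proof (rule Bochner_Integration.integral_cong[OF refl])
    fix x
    have n: "- t \<noteq> 0" using t by simp
    have pt: "complex_of_real t ^ DIM('a) \<noteq> 0" using t by simp
    have "(\<integral>y. cnj (b y) * P (y - x) \<partial>lborel) =
        complex_of_real (\<bar>- t\<bar> ^ DIM('a)) * (\<integral>z. cnj (b (x + (- t) *\<^sub>R z)) * P (x + (- t) *\<^sub>R z - x) \<partial>lborel)"
      by (rule lborel_integral_affine(1)[OF _ n]) measurable
    also have "\<dots> = (\<integral>z. (complex_of_real t ^ DIM('a)) * (cnj (b (x + (- t) *\<^sub>R z)) * P (x + (- t) *\<^sub>R z - x)) \<partial>lborel)"
      using t by simp
    also have "\<dots> = (\<integral>z. cnj (b (x - t *\<^sub>R z)) * std_gauss z \<partial>lborel)"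
    proof (rule Bochner_Integration.integral_cong[OF refl])
      fix z :: 'a
      have "P (x + (- t) *\<^sub>R z - x) = std_gauss z / complex_of_real t ^ DIM('a)"
        using t by (simp add: P_def std_gauss_eq)
      then show "(complex_of_real t ^ DIM('a)) * (cnj (b (x + (- t) *\<^sub>R z)) * P (x + (- t) *\<^sub>R z - x)) =
          cnj (b (x - t *\<^sub>R z)) * std_gauss z"
        using pt by simp
    qed
    finally show "(\<integral>y. a x * cnj (b y) * P (y - x) \<partial>lborel) =
        a x * (\<integral>z. cnj (b (x - t *\<^sub>R z)) * std_gauss z \<partial>lborel)"
      by (simp add: mult.assoc)
  qed
  finally show ?thesis .
qed

section \<open>Local mass is controlled by the square integral of the transform\<close>

lemma sets_borel_cball [measurable]: "cball (c::'a::euclidean_space) r \<in> sets borel"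
  by simp

text \<open>An average of values bounded by one is bounded by one; this one fact bounds both the energy of the
test function and the integrands in the passage to the limit.\<close>

lemma norm_gauss_average_le:
  fixes f :: "'a::euclidean_space \<Rightarrow> complex"
  assumes [measurable]: "f \<in> borel_measurable borel" and b: "\<And>z. norm (f z) \<le> 1"
  shows "norm (\<integral>z. f z * std_gauss z \<partial>lborel) \<le> 1"
proof -
  have i: "integrable lborel (\<lambda>z::'a. complex_of_real (std_gauss z))"
    by (intro integrable_of_real integrable_std_gauss)
  have i': "integrable lborel (\<lambda>z. f z * std_gauss z)"
    using integrable_mult_bounded[OF i assms] by (simp add: mult.commute)
  have "norm (\<integral>z. f z * std_gauss z \<partial>lborel) \<le> (\<integral>z. norm (f z * std_gauss z) \<partial>lborel)"
    by (rule integral_norm_bound)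
  also have "\<dots> \<le> (\<integral>z. std_gauss (z::'a) \<partial>lborel)"
    by (intro integral_mono integrable_norm[OF i'] integrable_std_gauss)
       (auto simp: norm_mult b std_gauss_nonneg mult_left_le_one_le)
  finally show ?thesis by (simp add: integral_std_gauss)
qed

lemma gauss_average_tendsto:
  fixes h :: "'a::euclidean_space \<Rightarrow> complex"
  assumes cont: "continuous_on UNIV h" and b: "\<And>x. norm (h x) \<le> 1"
    and s: "s \<longlonglongrightarrow> 0"
  shows "(\<lambda>k. \<integral>z. cnj (h (x - s k *\<^sub>R z)) * std_gauss z \<partial>lborel) \<longlonglongrightarrow> cnj (h x)"
proof -
  have [measurable]: "h \<in> borel_measurable borel"
    using cont by (rule borel_measurable_continuous_onI)
  have "(\<lambda>k. \<integral>z. cnj (h (x - s k *\<^sub>R z)) * std_gauss z \<partial>lborel)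
     \<longlonglongrightarrow> (\<integral>z. cnj (h x) * std_gauss (z::'a) \<partial>lborel)"
  proof (rule integral_dominated_convergence[OF _ _ integrable_std_gauss])
    show "AE z in lborel. (\<lambda>k. cnj (h (x - s k *\<^sub>R z)) * std_gauss z) \<longlonglongrightarrow> cnj (h x) * std_gauss z"
    proof (rule AE_I2)
      fix z :: 'a
      have "(\<lambda>k. x - s k *\<^sub>R z) \<longlonglongrightarrow> x - 0 *\<^sub>R z"
        by (intro tendsto_intros s)
      then have "(\<lambda>k. h (x - s k *\<^sub>R z)) \<longlonglongrightarrow> h x"
        using continuous_on_tendsto_compose[OF cont, of "\<lambda>k. x - s k *\<^sub>R z" x] by simp
      then show "(\<lambda>k. cnj (h (x - s k *\<^sub>R z)) * std_gauss z) \<longlonglongrightarrow> cnj (h x) * std_gauss z"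
        by (intro tendsto_intros)
    qed
    show "AE z in lborel. norm (cnj (h (x - s k *\<^sub>R z)) * std_gauss z) \<le> std_gauss z" for k
      by (auto simp: norm_mult b std_gauss_nonneg mult_left_le_one_le)
    show "(\<lambda>z. cnj (h (x - s k *\<^sub>R z)) * std_gauss z) \<in> borel_measurable lborel" for k
      by measurable
    show "(\<lambda>z::'a. cnj (h x) * std_gauss z) \<in> borel_measurable lborel"
      by measurable
  qed
  also have "(\<integral>z. cnj (h x) * std_gauss (z::'a) \<partial>lborel) = cnj (h x)"
    by (simp add: integral_std_gauss)
  finally show ?thesis .
qed

text \<open>Cauchy-Schwarz on the frequency side. In the weighted Parseval identity for \<open>u\<close> and \<open>h\<close> one separates
the transform of \<open>u\<close> from the weighted transform of \<open>h\<close>. The energy of the latter is at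
most the volume of the ball, by the same identity applied to \<open>h\<close> and \<open>h\<close>. The bound is uniform in
the width \<open>t\<close>, and as \<open>t\<close> tends to \<open>0\<close> the smoothing of \<open>h\<close> converges to \<open>h\<close> by continuity.
Thus a continuous \<open>h\<close> carries all the regularity, and \<open>u\<close> may be any integrable function.\<close>

lemma pairing_le_fourier_L2:
  fixes u h :: "'a::euclidean_space \<Rightarrow> complex"
  assumes u: "integrable lborel u" and cont: "continuous_on UNIV h"
    and b: "\<And>x. norm (h x) \<le> 1" and supp: "\<And>x. x \<notin> cball 0 \<rho> \<Longrightarrow> h x = 0"
  shows "(ennreal (norm (\<integral>x. u x * cnj (h x) \<partial>lborel)))\<^sup>2 \<le>
    (\<integral>\<^sup>+\<xi>. (ennreal (norm (lborel_fourier u \<xi>)))\<^sup>2 \<partial>lborel) * emeasure lborel (cball 0 \<rho> :: 'a set)"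
    (is "_ \<le> ?J * ?V")
proof -
  have [measurable]: "h \<in> borel_measurable borel"
    using cont by (rule borel_measurable_continuous_onI)
  have [measurable]: "u \<in> borel_measurable borel" using u by auto
  have V: "?V < \<infinity>" by (intro emeasure_bounded_finite) auto
  have hind: "norm (h x) \<le> indicator (cball 0 \<rho>) x" for x
    using b[of x] supp[of x] by (auto simp: indicator_def)
  have ind: "integrable lborel (indicator (cball 0 \<rho> :: 'a set) :: 'a \<Rightarrow> real)"
    using V by simp
  have h: "integrable lborel h"
    by (rule Bochner_Integration.integrable_bound[OF ind]) (auto simp: hind)
  have hV: "ennreal (\<integral>x. norm (h x) \<partial>lborel) \<le> ?V"
  proof -
    have "ennreal (\<integral>x. norm (h x) \<partial>lborel) = (\<integral>\<^sup>+x. norm (h x) \<partial>lborel)"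
      using h by (intro nn_integral_eq_integral[symmetric]) auto
    also have "\<dots> \<le> (\<integral>\<^sup>+x. indicator (cball 0 \<rho> :: 'a set) x \<partial>lborel)"
    proof (rule nn_integral_mono)
      show "ennreal (norm (h x)) \<le> indicator (cball 0 \<rho>) x" for x
        using b[of x] supp[of x] by (cases "x \<in> cball 0 \<rho>") auto
    qed
    finally show ?thesis by simp
  qed
  have fb: "norm (lborel_fourier u \<xi> * cnj (lborel_fourier h \<xi>)) \<le>
       (\<integral>x. norm (u x) \<partial>lborel) * (\<integral>x. norm (h x) \<partial>lborel)"
    if "integrable lborel u" for u \<xi>
    using norm_lborel_fourier_le[OF that, of \<xi>] norm_lborel_fourier_le[OF h, of \<xi>]
    by (auto simp: norm_mult intro!: mult_mono)
  have ib: "integrable lborel (\<lambda>\<xi>. lborel_fourier u \<xi> * cnj (lborel_fourier h \<xi>) * gauss_weight t \<xi>)"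
    if "t > 0" "integrable lborel u" for t u
  proof -
    have [measurable]: "u \<in> borel_measurable borel" using that by auto
    have "(\<lambda>\<xi>. lborel_fourier u \<xi> * cnj (lborel_fourier h \<xi>)) \<in> borel_measurable borel"
      by measurable
    from integrable_mult_bounded[OF integrable_gauss_weight[OF that(1)] this fb[OF that(2)]]
    show ?thesis by (simp add: mult.commute)
  qed
  define I where "I t = (\<integral>\<xi>. lborel_fourier u \<xi> * cnj (lborel_fourier h \<xi>) * gauss_weight t \<xi> \<partial>lborel)" for t
  have energy: "(\<integral>\<^sup>+\<xi>. (ennreal (norm (lborel_fourier h \<xi>) * gauss_weight t \<xi>))\<^sup>2 \<partial>lborel) \<le> ?V"
    if t: "t > 0" for t
  proof -
    let ?f = "\<lambda>\<xi>. (norm (lborel_fourier h \<xi>))\<^sup>2 * gauss_weight t \<xi>"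
    have eq: "complex_of_real (?f \<xi>) = lborel_fourier h \<xi> * cnj (lborel_fourier h \<xi>) * gauss_weight t \<xi>" for \<xi>
      by (simp only: of_real_mult complex_norm_square)
    have i: "integrable lborel ?f"
      using integrable_norm[OF ib[OF t h]] by (simp add: norm_mult power2_eq_square gauss_weight_bounds)
    have "(\<integral>\<^sup>+\<xi>. (ennreal (norm (lborel_fourier h \<xi>) * gauss_weight t \<xi>))\<^sup>2 \<partial>lborel) \<le> (\<integral>\<^sup>+\<xi>. ennreal (?f \<xi>) \<partial>lborel)"
    proof (intro nn_integral_mono)
      fix \<xi> :: 'a
      \<comment> \<open>a square of the weight may be replaced by the weight itself, which is at most one\<close>
      have "(gauss_weight t \<xi>)\<^sup>2 \<le> gauss_weight t \<xi>"
        using gauss_weight_bounds[of t \<xi>] by (simp add: power2_eq_square mult_left_le)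
      then show "(ennreal (norm (lborel_fourier h \<xi>) * gauss_weight t \<xi>))\<^sup>2 \<le> ennreal (?f \<xi>)"
        using gauss_weight_bounds(1)[of t \<xi>]
        by (auto simp: ennreal_power power_mult_distrib intro!: ennreal_leI mult_left_mono)
    qed
    also have "\<dots> = ennreal (\<integral>\<xi>. ?f \<xi> \<partial>lborel)"
      using i by (intro nn_integral_eq_integral) (auto simp: gauss_weight_bounds)
    also have "\<dots> \<le> ennreal (\<integral>x. norm (h x) \<partial>lborel)"
    proof (rule ennreal_leI)
      let ?A = "\<lambda>x. \<integral>z. cnj (h (x - t *\<^sub>R z)) * std_gauss z \<partial>lborel"
      have A: "norm (?A x) \<le> 1" for x
        by (rule norm_gauss_average_le) (auto simp: b)
      have ih: "integrable lborel (\<lambda>x. h x * ?A x)"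
        by (rule integrable_mult_bounded[OF h _ A]) measurable
      have "(\<integral>\<xi>. ?f \<xi> \<partial>lborel) \<le> norm (complex_of_real (\<integral>\<xi>. ?f \<xi> \<partial>lborel))"
        by simp
      also have "complex_of_real (\<integral>\<xi>. ?f \<xi> \<partial>lborel) = (\<integral>x. h x * ?A x \<partial>lborel)"
        unfolding gauss_weighted_Parseval[OF h h t, symmetric] eq[symmetric] by (rule integral_complex_of_real[symmetric])
      also have "norm \<dots> \<le> (\<integral>x. norm (h x * ?A x) \<partial>lborel)"
        by (rule integral_norm_bound)
      also have "\<dots> \<le> (\<integral>x. norm (h x) \<partial>lborel)"
        by (intro integral_mono integrable_norm ih h) (use A in \<open>auto simp: norm_mult mult_left_le\<close>)
      finally show "(\<integral>\<xi>. ?f \<xi> \<partial>lborel) \<le> (\<integral>x. norm (h x) \<partial>lborel)" .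
    qed
    also note hV
    finally show ?thesis .
  qed
  have bound: "(ennreal (norm (I t)))\<^sup>2 \<le> ?J * ?V" if t: "t > 0" for t
  proof -
    have "ennreal (norm (I t)) \<le>
        (\<integral>\<^sup>+\<xi>. norm (lborel_fourier u \<xi> * cnj (lborel_fourier h \<xi>) * gauss_weight t \<xi>) \<partial>lborel)"
      unfolding I_def by (rule integral_norm_bound_ennreal[OF ib[OF t u]])
    also have "\<dots> = (\<integral>\<^sup>+\<xi>. ennreal (norm (lborel_fourier u \<xi>)) * ennreal (norm (lborel_fourier h \<xi>) * gauss_weight t \<xi>) \<partial>lborel)"
      by (simp add: norm_mult mult.assoc abs_of_nonneg[OF gauss_weight_bounds(1)] gauss_weight_bounds
          flip: ennreal_mult)
    finally have "(ennreal (norm (I t)))\<^sup>2 \<le> (\<dots>)\<^sup>2"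
      by (intro power_mono) auto
    also have "\<dots> \<le> ?J * (\<integral>\<^sup>+\<xi>. (ennreal (norm (lborel_fourier h \<xi>) * gauss_weight t \<xi>))\<^sup>2 \<partial>lborel)"
      by (rule Cauchy_Schwarz_nn_integral) measurable
    also have "\<dots> \<le> ?J * ?V"
      by (intro mult_left_mono energy t) auto
    finally show ?thesis .
  qed
  define s where "s k = 1 / real (Suc k)" for k
  have s: "s \<longlonglongrightarrow> 0" "s k > 0" for k
    unfolding s_def [abs_def] by (rule LIMSEQ_Suc[OF lim_1_over_n]) simp
  have "(\<lambda>k. I (s k)) \<longlonglongrightarrow> (\<integral>x. u x * cnj (h x) \<partial>lborel)"
    unfolding I_def gauss_weighted_Parseval[OF u h s(2)]
  proof (rule integral_dominated_convergence[OF _ _ integrable_norm[OF u]])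
    show "AE x in lborel. (\<lambda>k. u x * (\<integral>z. cnj (h (x - s k *\<^sub>R z)) * std_gauss z \<partial>lborel)) \<longlonglongrightarrow> u x * cnj (h x)"
      by (intro AE_I2 tendsto_intros gauss_average_tendsto cont b s)
    show "AE x in lborel. norm (u x * (\<integral>z. cnj (h (x - s k *\<^sub>R z)) * std_gauss z \<partial>lborel)) \<le> norm (u x)" for k
      by (intro AE_I2) (auto simp: norm_mult b intro!: mult_left_le norm_gauss_average_le)
    show "(\<lambda>x. u x * (\<integral>z. cnj (h (x - s k *\<^sub>R z)) * std_gauss z \<partial>lborel)) \<in> borel_measurable lborel" for k
      by measurable
    show "(\<lambda>x. u x * cnj (h x)) \<in> borel_measurable lborel"
      by measurable
  qed
  then have "(\<lambda>k. ennreal ((norm (I (s k)))\<^sup>2)) \<longlonglongrightarrow> ennreal ((norm (\<integral>x. u x * cnj (h x) \<partial>lborel))\<^sup>2)"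
    by (intro tendsto_intros)
  then have "ennreal ((norm (\<integral>x. u x * cnj (h x) \<partial>lborel))\<^sup>2) \<le> ?J * ?V"
    by (rule Lim_bounded) (use bound[OF s(2)] in \<open>simp add: ennreal_power\<close>)
  then show ?thesis by (simp add: ennreal_power)
qed

text \<open>A measurable function, here the sign of \<open>u\<close> on the ball, is an almost everywhere limit of continuous
functions. Retracting their values radially to the unit disc and multiplying by a cutoff that equals one on
the ball does not change the limit and makes them admissible test functions.\<close>

lemma continuous_approx_sgn_on_cball:
  fixes u :: "'a::euclidean_space \<Rightarrow> complex"
  assumes u: "u \<in> borel_measurable lborel" and R: "R > 0"
  obtains h :: "nat \<Rightarrow> 'a \<Rightarrow> complex"
  where "\<And>k. continuous_on UNIV (h k)" "\<And>k x. norm (h k x) \<le> 1"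
    "\<And>k x. x \<notin> cball 0 (2 * R) \<Longrightarrow> h k x = 0"
    "AE x in lborel. (\<lambda>k. h k x) \<longlonglongrightarrow> indicator (cball 0 R) x * sgn (u x)"
proof -
  define \<phi> where "\<phi> x = indicator (cball 0 R) x * sgn (u x)" for x
  have \<phi>_if: "(if x \<in> cball 0 R then sgn (u x) else 0) = \<phi> x" for x
    by (simp add: \<phi>_def)
  have "(\<lambda>x. sgn (u x)) \<in> borel_measurable lebesgue"
    using u by (intro measurable_completion) (auto simp: sgn_div_norm)
  then have "(\<lambda>x. sgn (u x)) measurable_on cball 0 R"
    by (rule lebesgue_measurable_imp_measurable_on) auto
  then obtain N g where N: "negligible N" and g: "\<And>n. continuous_on UNIV (g n)"
    and lim: "\<And>x. x \<notin> N \<Longrightarrow> (\<lambda>n. g n x) \<longlonglongrightarrow> \<phi> x"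
    unfolding measurable_on_def \<phi>_if by blast
  define cut where "cut x = max 0 (min 1 (2 - norm x / R))" for x :: 'a
  define trunc where "trunc z = z /\<^sub>R max 1 (norm z)" for z :: complex
  have trunc: "norm (trunc z) \<le> 1" for z
    by (auto simp: trunc_def field_simps)
  have trunc_cont: "continuous_on UNIV trunc"
    unfolding trunc_def by (intro continuous_intros) auto
  define h where "h n x = cut x *\<^sub>R trunc (g n x)" for n x
  have "continuous_on UNIV (h n)" for n
    unfolding h_def cut_def
    by (intro continuous_intros continuous_on_compose2[OF trunc_cont g]) (use R in auto)
  moreover have "norm (h n x) \<le> 1" for n x
    using trunc[of "g n x"] by (auto simp: h_def cut_def intro!: mult_le_one)
  moreover have "h n x = 0" if "x \<notin> cball 0 (2 * R)" for n x
    using that R by (auto simp: h_def cut_def field_simps)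
  moreover have "AE x in lborel. (\<lambda>k. h k x) \<longlonglongrightarrow> indicator (cball 0 R) x * sgn (u x)"
  proof -
    have "N \<in> null_sets lebesgue" using N by (simp add: negligible_iff_null_sets)
    then have "AE x in lebesgue. x \<notin> N" by (rule AE_not_in)
    then have "AE x in lborel. x \<notin> N" by (simp add: AE_completion_iff)
    then show ?thesis
    proof eventually_elim
      case (elim x)
      have "isCont trunc (\<phi> x)" using trunc_cont by (simp add: continuous_on_eq_continuous_at)
      then have "(\<lambda>k. trunc (g k x)) \<longlonglongrightarrow> trunc (\<phi> x)"
        using lim[OF elim] by (rule isCont_tendsto_compose)
      then have "(\<lambda>k. h k x) \<longlonglongrightarrow> cut x *\<^sub>R trunc (\<phi> x)"
        unfolding h_def by (intro tendsto_intros)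
      moreover have "norm (\<phi> x) \<le> 1" by (simp add: \<phi>_def norm_mult norm_sgn indicator_def)
      then have "trunc (\<phi> x) = \<phi> x" by (simp add: trunc_def max_def)
      moreover have "cut x *\<^sub>R \<phi> x = \<phi> x"
        using R by (auto simp: cut_def \<phi>_def indicator_def field_simps max_def min_def)
      ultimately show ?case by (simp add: \<phi>_def)
    qed
  qed
  ultimately show ?thesis by (rule that)
qed

text \<open>This is the part of Plancherel's theorem that the uncertainty inequality needs, in the form it takes
after Cauchy-Schwarz on a ball. The left-hand side is the pairing of \<open>u\<close> with its own sign, reached
as a limit of pairings with continuous test functions; the doubled radius leaves room for
their cutoff.\<close>

lemma local_L1_le_fourier_L2:
  fixes u :: "'a::euclidean_space \<Rightarrow> complex"
  assumes u: "integrable lborel u" and R: "R > 0"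
  shows "(\<integral>\<^sup>+x. norm (u x) * indicator (cball 0 R) x \<partial>lborel)\<^sup>2 \<le>
    (\<integral>\<^sup>+\<xi>. (ennreal (norm (lborel_fourier u \<xi>)))\<^sup>2 \<partial>lborel) * emeasure lborel (cball 0 (2 * R) :: 'a set)"
    (is "_ \<le> ?B")
proof -
  have [measurable]: "u \<in> borel_measurable borel" using u by auto
  obtain h :: "nat \<Rightarrow> 'a \<Rightarrow> complex"
  where cont: "\<And>k. continuous_on UNIV (h k)" and b: "\<And>k x. norm (h k x) \<le> 1"
    and supp: "\<And>k x. x \<notin> cball 0 (2 * R) \<Longrightarrow> h k x = 0"
    and lim: "AE x in lborel. (\<lambda>k. h k x) \<longlonglongrightarrow> indicator (cball 0 R) x * sgn (u x)"
    using continuous_approx_sgn_on_cball[OF _ R, of u] u by auto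
  have [measurable]: "h k \<in> borel_measurable borel" for k
    using cont by (rule borel_measurable_continuous_onI)
  have "(\<lambda>k. \<integral>x. u x * cnj (h k x) \<partial>lborel) \<longlonglongrightarrow>
      (\<integral>x. complex_of_real (norm (u x) * indicator (cball 0 R) x) \<partial>lborel)"
  \<comment> \<open>the test functions are bounded by one, so \<open>norm (u x)\<close> dominates\<close>
  proof (rule integral_dominated_convergence[OF _ _ integrable_norm[OF u]])
    show "AE x in lborel. (\<lambda>k. u x * cnj (h k x)) \<longlonglongrightarrow> complex_of_real (norm (u x) * indicator (cball 0 R) x)"
      using lim
    proof eventually_elim
      case (elim x)
      then have "(\<lambda>k. u x * cnj (h k x)) \<longlonglongrightarrow> u x * cnj (indicator (cball 0 R) x * sgn (u x))"
        by (intro tendsto_intros)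
      also have "u x * cnj (indicator (cball 0 R) x * sgn (u x)) = complex_of_real (norm (u x) * indicator (cball 0 R) x)"
        by (cases "u x = 0")
           (auto simp: sgn_div_norm indicator_def scaleR_conv_of_real field_simps
              complex_norm_square[symmetric] power2_eq_square)
      finally show ?case .
    qed
    show "AE x in lborel. norm (u x * cnj (h k x)) \<le> norm (u x)" for k
      by (auto simp: norm_mult b mult_left_le)
    show "(\<lambda>x. u x * cnj (h k x)) \<in> borel_measurable lborel" for k
      by measurable
    show "(\<lambda>x. complex_of_real (norm (u x) * indicator (cball 0 R) x)) \<in> borel_measurable lborel"
      by measurable
  qed
  then have "(\<lambda>k. ennreal ((norm (\<integral>x. u x * cnj (h k x) \<partial>lborel))\<^sup>2)) \<longlonglongrightarrow>
      ennreal ((norm (\<integral>x. complex_of_real (norm (u x) * indicator (cball 0 R) x) \<partial>lborel))\<^sup>2)"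
    by (intro tendsto_intros)
  then have "ennreal ((norm (\<integral>x. complex_of_real (norm (u x) * indicator (cball 0 R) x) \<partial>lborel))\<^sup>2) \<le> ?B"
    by (rule Lim_bounded)
       (use pairing_le_fourier_L2[OF u cont b supp] in \<open>simp add: ennreal_power\<close>)
  also have "(\<integral>x. complex_of_real (norm (u x) * indicator (cball 0 R) x) \<partial>lborel) =
      complex_of_real (\<integral>x. norm (u x) * indicator (cball 0 R) x \<partial>lborel)"
    by (rule integral_complex_of_real)
  also have "ennreal ((norm (complex_of_real (\<integral>x. norm (u x) * indicator (cball 0 R) x \<partial>lborel)))\<^sup>2) =
      (ennreal (\<integral>x. norm (u x) * indicator (cball 0 R) x \<partial>lborel))\<^sup>2"
    by (simp add: ennreal_power)
  also have "ennreal (\<integral>x. norm (u x) * indicator (cball 0 R) x \<partial>lborel) =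
      (\<integral>\<^sup>+x. norm (u x) * indicator (cball 0 R) x \<partial>lborel)"
    using u by (intro nn_integral_eq_integral[symmetric] integrable_real_mult_indicator) auto
  finally show ?thesis .
qed

text \<open>A vanishing transform leaves no mass on any ball. This settles the degenerate case in which the
supremum factor of the inequality is zero and the other factor may be infinite.\<close>

lemma lborel_fourier_injective:
  fixes u :: "'a::euclidean_space \<Rightarrow> complex"
  assumes u: "integrable lborel u" and z: "AE \<xi> in lborel. lborel_fourier u \<xi> = 0"
  shows "AE x in lborel. u x = 0"
proof -
  have [measurable]: "u \<in> borel_measurable borel" using u by auto
  have "AE x in lborel. x \<in> cball 0 (real (Suc k)) \<longrightarrow> u x = 0" for k
  proof -
    have "(\<integral>\<^sup>+\<xi>. (ennreal (norm (lborel_fourier u \<xi>)))\<^sup>2 \<partial>lborel) = (\<integral>\<^sup>+(\<xi>::'a). 0 \<partial>lborel)"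
      using z by (intro nn_integral_cong_AE) auto
    then have "(\<integral>\<^sup>+x. norm (u x) * indicator (cball 0 (real (Suc k))) x \<partial>lborel) = 0"
      using local_L1_le_fourier_L2[OF u, of "real (Suc k)"] by simp
    then have "AE x in lborel. ennreal (norm (u x) * indicator (cball 0 (real (Suc k))) x) = 0"
      by (subst (asm) nn_integral_0_iff_AE) auto
    then show ?thesis by eventually_elim (auto simp: indicator_def)
  qed
  then have "AE x in lborel. \<forall>k. x \<in> cball 0 (real (Suc k)) \<longrightarrow> u x = 0"
    by (intro AE_all_countable[THEN iffD2] allI)
  then show ?thesis
  proof eventually_elim
    case (elim x)
    obtain k where "norm x \<le> real k" using real_arch_simple by blast
    then show ?case using elim[rule_format, of k] by simp
  qed
qed

section \<open>The square integral of the transform\<close>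

lemma dyadic_shell:
  fixes s r :: real
  assumes "0 < r" "r \<le> s"
  obtains k :: nat where "2 ^ k * r \<le> s" "s < 2 ^ Suc k * r"
proof -
  obtain m :: nat where "s / r < 2 ^ m"
    using real_arch_pow[of 2 "s / r"] by auto
  then have ex: "\<exists>m::nat. s < 2 ^ m * r"
    using assms by (auto simp: field_simps)
  define m where "m = (LEAST m::nat. s < 2 ^ m * r)"
  have m: "s < 2 ^ m * r" unfolding m_def using ex by (rule LeastI_ex)
  with assms have "m \<noteq> 0" by (auto intro: ccontr)
  then obtain k where k: "m = Suc k" by (cases m) auto
  have "\<not> s < 2 ^ k * r" using not_less_Least[of k "\<lambda>m. s < 2 ^ m * r"] k by (simp add: m_def)
  with m k show ?thesis by (intro that[of k]) auto
qed

text \<open>On the dyadic shell of index \<open>k\<close> the integrand is at most its value on the inner sphere, and the volume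
is at most that of the outer ball. The contributions form a geometric series with ratio
\<open>2 powr (DIM('a) - 2 * \<beta>)\<close>; that this ratio is below one is exactly the condition
\<open>\<beta> > DIM('a) / 2\<close>.\<close>

lemma nn_integral_powr_tail_le:
  fixes \<beta> r :: real
  assumes \<beta>: "\<beta> > real DIM('a) / 2" and r: "r > 0"
  shows "(\<integral>\<^sup>+\<xi>. ennreal (norm \<xi> powr (- 2 * \<beta>)) * indicator {\<xi>. r \<le> norm \<xi>} \<xi> \<partial>(lborel :: 'a::euclidean_space measure))
    \<le> ennreal (unit_ball_vol (real DIM('a)) * 2 ^ DIM('a) / (1 - 2 powr (DIM('a) - 2 * \<beta>)) * r powr (DIM('a) - 2 * \<beta>))"
proof -
  define n where "n = DIM('a)"
  define V where "V = unit_ball_vol (real n)"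
  have V: "V \<ge> 0" by (simp add: V_def)
  define q where "q = 2 powr (n - 2 * \<beta>)"
  have q: "0 < q" "q < 1"
    using \<beta> powr_less_mono[of "n - 2 * \<beta>" 0 2] by (auto simp: q_def n_def)
  let ?f = "\<lambda>k \<xi>. ennreal ((2 ^ k * r) powr (- 2 * \<beta>)) * indicator (cball 0 (2 ^ Suc k * r)) (\<xi> :: 'a)"
  have term_le: "g k \<le> (\<Sum>j. g j)" for g :: "nat \<Rightarrow> ennreal" and k
    using sum_le_suminf[of g "{k}"] by simp
  have pw: "ennreal (norm \<xi> powr (- 2 * \<beta>)) * indicator {\<xi>. r \<le> norm \<xi>} \<xi> \<le> (\<Sum>k. ?f k \<xi>)" for \<xi> :: 'a
  proof (cases "r \<le> norm \<xi>")
    case True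
    obtain k where k: "2 ^ k * r \<le> norm \<xi>" "norm \<xi> < 2 ^ Suc k * r"
      using dyadic_shell[OF r True] .
    have "\<beta> > 0" using \<beta> by (meson divide_nonneg_pos less_le_trans not_le of_nat_0_le_iff zero_less_numeral)
    have "ennreal (norm \<xi> powr (- 2 * \<beta>)) * indicator {\<xi>. r \<le> norm \<xi>} \<xi> \<le> ?f k \<xi>"
      using k True r \<open>\<beta> > 0\<close> by (auto intro!: ennreal_leI powr_mono2')
    also have "\<dots> \<le> (\<Sum>j. ?f j \<xi>)"
      by (rule term_le)
    finally show ?thesis .
  qed simp
  have "(\<integral>\<^sup>+\<xi>. ennreal (norm \<xi> powr (- 2 * \<beta>)) * indicator {\<xi>. r \<le> norm \<xi>} \<xi> \<partial>(lborel :: 'a measure))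
      \<le> (\<integral>\<^sup>+\<xi>. (\<Sum>k. ?f k \<xi>) \<partial>lborel)"
    by (intro nn_integral_mono pw)
  also have "\<dots> = (\<Sum>k. \<integral>\<^sup>+\<xi>. ?f k \<xi> \<partial>lborel)"
    by (rule nn_integral_suminf) auto
  also have "\<dots> = (\<Sum>k. ennreal (V * 2 ^ n * r powr (n - 2 * \<beta>) * q ^ k))"
  proof (rule suminf_cong)
    fix k
    have "(\<integral>\<^sup>+\<xi>. ?f k \<xi> \<partial>lborel) = ennreal ((2 ^ k * r) powr (- 2 * \<beta>)) * ennreal (V * (2 ^ Suc k * r) ^ n)"
      using r by (simp add: nn_integral_cmult_indicator emeasure_cball V_def n_def)
    also have "\<dots> = ennreal ((2 ^ k * r) powr (- 2 * \<beta>) * (V * (2 ^ Suc k * r) ^ n))"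
      using V r by (simp add: ennreal_mult)
    also have "(2 ^ Suc k * r) ^ n = 2 ^ n * (2 ^ k * r) powr n"
      using r by (simp add: powr_realpow power_mult_distrib)
    also have "(2 ^ k * r) powr (- 2 * \<beta>) * (V * (2 ^ n * (2 ^ k * r) powr n)) = V * 2 ^ n * (2 ^ k * r) powr (n - 2 * \<beta>)"
      by (simp add: powr_add[symmetric])
    also have "(2 ^ k * r) powr (n - 2 * \<beta>) = r powr (n - 2 * \<beta>) * q ^ k"
      using r by (simp add: powr_mult q_def powr_powr mult.commute flip: powr_realpow)
    finally show "(\<integral>\<^sup>+\<xi>. ?f k \<xi> \<partial>lborel) = ennreal (V * 2 ^ n * r powr (n - 2 * \<beta>) * q ^ k)"
      by (simp add: mult.assoc)
  qed
  also have "\<dots> = ennreal (V * 2 ^ n * r powr (n - 2 * \<beta>) * (1 / (1 - q)))"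
    using q V by (intro suminf_ennreal_eq sums_mult geometric_sums) auto
  finally show ?thesis by (simp add: V_def n_def q_def mult_ac)
qed

text \<open>At low frequencies the transform is bounded by the \<open>L\<^sup>1\<close> norm of \<open>u\<close>, at high frequencies by
\<open>A * norm \<xi> powr (- \<beta>)\<close>; the radius \<open>r\<close> separating the two regimes stays free.\<close>

lemma fourier_L2_le:
  fixes u :: "'a::euclidean_space \<Rightarrow> complex" and \<beta> :: real
  assumes u: "integrable lborel u" and \<beta>: "\<beta> > real DIM('a) / 2" and r: "r > 0"
    and A: "AE \<xi> in lborel. norm \<xi> powr \<beta> * norm (lborel_fourier u \<xi>) \<le> A" "A \<ge> 0"
  shows "(\<integral>\<^sup>+\<xi>. (ennreal (norm (lborel_fourier u \<xi>)))\<^sup>2 \<partial>lborel) \<le>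
    ennreal (unit_ball_vol DIM('a) * r ^ DIM('a) * (\<integral>x. norm (u x) \<partial>lborel)\<^sup>2 +
      unit_ball_vol (real DIM('a)) * 2 ^ DIM('a) / (1 - 2 powr (DIM('a) - 2 * \<beta>)) * A\<^sup>2 * r powr (DIM('a) - 2 * \<beta>))"
    (is "_ \<le> ennreal (?V * _ * ?M\<^sup>2 + ?C * _ * _)")
proof -
  have q: "2 powr (DIM('a) - 2 * \<beta>) < 1"
    using \<beta> powr_less_mono[of "DIM('a) - 2 * \<beta>" 0 2] by auto
  have C: "?C \<ge> 0" using q by simp
  let ?tail = "\<lambda>\<xi>::'a. ennreal (norm \<xi> powr (- 2 * \<beta>)) * indicator {\<xi>. r \<le> norm \<xi>} \<xi>"
  have "(\<integral>\<^sup>+\<xi>. (ennreal (norm (lborel_fourier u \<xi>)))\<^sup>2 \<partial>lborel) \<le>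
     (\<integral>\<^sup>+\<xi>. ennreal (?M\<^sup>2) * indicator (cball 0 r) \<xi> + ennreal (A\<^sup>2) * ?tail \<xi> \<partial>lborel)"
  proof (intro nn_integral_mono_AE, use A(1) in eventually_elim)
    case (elim \<xi>)
    show ?case
    proof (cases "norm \<xi> \<le> r")
      case True
      have "(norm (lborel_fourier u \<xi>))\<^sup>2 \<le> ?M\<^sup>2"
        by (intro power_mono norm_lborel_fourier_le u) auto
      then have "(ennreal (norm (lborel_fourier u \<xi>)))\<^sup>2 \<le> ennreal (?M\<^sup>2) * indicator (cball 0 r) \<xi>"
        using True by (auto simp: ennreal_power ennreal_leI)
      also have "\<dots> \<le> ennreal (?M\<^sup>2) * indicator (cball 0 r) \<xi> + ennreal (A\<^sup>2) * ?tail \<xi>"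
        by simp
      finally show ?thesis .
    next
      case False
      then have p: "norm \<xi> > 0" using r by linarith
      then have "norm (lborel_fourier u \<xi>) \<le> A * norm \<xi> powr (- \<beta>)"
        using elim by (simp add: powr_minus field_simps)
      then have "(norm (lborel_fourier u \<xi>))\<^sup>2 \<le> (A * norm \<xi> powr (- \<beta>))\<^sup>2"
        by (intro power_mono) auto
      also have "\<dots> = A\<^sup>2 * norm \<xi> powr (- 2 * \<beta>)"
        using p by (simp add: power_mult_distrib powr_power)
      finally have "(ennreal (norm (lborel_fourier u \<xi>)))\<^sup>2 \<le> ennreal (A\<^sup>2) * ?tail \<xi>"
        using False by (simp add: ennreal_power ennreal_leI flip: ennreal_mult)
      also have "\<dots> \<le> ennreal (?M\<^sup>2) * indicator (cball 0 r) \<xi> + ennreal (A\<^sup>2) * ?tail \<xi>"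
        by simp
      finally show ?thesis .
    qed
  qed
  also have "\<dots> = ennreal (?M\<^sup>2) * emeasure lborel (cball 0 r :: 'a set) + ennreal (A\<^sup>2) * (\<integral>\<^sup>+\<xi>. ?tail \<xi> \<partial>lborel)"
    by (subst nn_integral_add) (auto simp: nn_integral_cmult nn_integral_cmult_indicator)
  also have "\<dots> \<le> ennreal (?M\<^sup>2) * ennreal (?V * r ^ DIM('a)) + ennreal (A\<^sup>2) * ennreal (?C * r powr (DIM('a) - 2 * \<beta>))"
    using r by (intro add_mono mult_left_mono nn_integral_powr_tail_le \<beta>) (auto simp: emeasure_cball)
  also have "\<dots> = ennreal (?V * r ^ DIM('a) * ?M\<^sup>2 + ?C * A\<^sup>2 * r powr (DIM('a) - 2 * \<beta>))"
  proof -
    have "ennreal m * ennreal v + ennreal a * ennreal t = ennreal (v * m + t * a)"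
      if "0 \<le> m" "0 \<le> v" "0 \<le> a" "0 \<le> t" for m v a t :: real
      using that by (simp add: ennreal_mult ennreal_plus mult.commute)
    moreover have "0 \<le> ?V * r ^ DIM('a)" "0 \<le> ?C * r powr (DIM('a) - 2 * \<beta>)"
      using r by (simp, intro mult_nonneg_nonneg C) simp
    ultimately have "ennreal (?M\<^sup>2) * ennreal (?V * r ^ DIM('a)) + ennreal (A\<^sup>2) * ennreal (?C * r powr (DIM('a) - 2 * \<beta>)) =
        ennreal ((?V * r ^ DIM('a)) * ?M\<^sup>2 + (?C * r powr (DIM('a) - 2 * \<beta>)) * A\<^sup>2)"
      by (metis zero_le_power2)
    then show ?thesis by (simp only: mult_ac)
  qed
  finally show ?thesis .
qed

section \<open>Concentration in physical space\<close>

text \<open>Chebyshev's inequality: outside a ball of radius \<open>R\<close> the mass is at most \<open>B / R powr \<alpha>\<close>, and the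
radius is the one for which this equals \<open>M / 2\<close>.\<close>

lemma concentration_radius:
  fixes u :: "'a::euclidean_space \<Rightarrow> complex"
  assumes u: "integrable lborel u" and \<alpha>: "\<alpha> > 0"
    and i: "integrable lborel (\<lambda>x. norm x powr \<alpha> * norm (u x))"
    and B: "(\<integral>x. norm x powr \<alpha> * norm (u x) \<partial>lborel) = B" "B > 0"
    and M: "(\<integral>x. norm (u x) \<partial>lborel) = M" "M > 0"
  shows "M / 2 \<le> (\<integral>x. norm (u x) * indicator (cball 0 ((2 * B / M) powr (1 / \<alpha>))) x \<partial>lborel)"
proof -
  define R where "R = (2 * B / M) powr (1 / \<alpha>)"
  have R: "R > 0" "R powr \<alpha> = 2 * B / M"
    using B(2) M(2) \<alpha> by (auto simp: R_def powr_powr)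
  have ii: "integrable lborel (\<lambda>x. norm (u x) * indicator (cball 0 R) x)"
    using u by (intro integrable_real_mult_indicator) auto
  have "M = (\<integral>x. norm (u x) \<partial>lborel)" using M by simp
  also have "\<dots> \<le> (\<integral>x. norm (u x) * indicator (cball 0 R) x + (norm x powr \<alpha> * norm (u x)) / R powr \<alpha> \<partial>lborel)"
  proof (rule integral_mono)
    fix x
    show "norm (u x) \<le> norm (u x) * indicator (cball 0 R) x + (norm x powr \<alpha> * norm (u x)) / R powr \<alpha>"
    proof (cases "norm x \<le> R")
      case False
      then have "R powr \<alpha> \<le> norm x powr \<alpha>" using R \<alpha> by (intro powr_mono2) auto
      then have "R powr \<alpha> * norm (u x) \<le> norm x powr \<alpha> * norm (u x)" by (intro mult_right_mono) auto
      then show ?thesis using False R(1) by (simp add: field_simps)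
    qed (use R(1) in auto)
  qed (use u i ii in auto)
  also have "\<dots> = (\<integral>x. norm (u x) * indicator (cball 0 R) x \<partial>lborel) + B / R powr \<alpha>"
    using i ii B by simp
  also have "B / R powr \<alpha> = M / 2" using B(2) M(2) by (simp add: R(2))
  finally show ?thesis by (simp add: R_def)
qed

text \<open>If half the mass of \<open>u\<close> sits in a ball of radius \<open>R\<close>, the squared mass is at most a constant times
\<open>R ^ DIM('a)\<close> times the square integral of the transform. Splitting frequencies at \<open>r = \<delta> / R\<close>, the low-frequency part becomes
a multiple of \<open>\<delta> ^ DIM('a)\<close> times the squared mass, free of \<open>R\<close>, so that for small \<open>\<delta>\<close> it is
absorbed by the left-hand side and only the high-frequency part remains.\<close>

lemma L1_le_of_concentration:
  fixes \<beta> :: real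
  assumes \<beta>: "\<beta> > real DIM('a) / 2"
  obtains D where "D > 0"
    "\<And>(u :: 'a::euclidean_space \<Rightarrow> complex) A R. integrable lborel u \<Longrightarrow> R > 0 \<Longrightarrow> A \<ge> 0 \<Longrightarrow>
       AE \<xi> in lborel. norm \<xi> powr \<beta> * norm (lborel_fourier u \<xi>) \<le> A \<Longrightarrow>
       (\<integral>x. norm (u x) \<partial>lborel) / 2 \<le> (\<integral>x. norm (u x) * indicator (cball 0 R) x \<partial>lborel) \<Longrightarrow>
       (\<integral>x. norm (u x) \<partial>lborel) \<le> D * A * R powr \<beta>"
proof -
  define n where "n = DIM('a)"
  have n: "n > 0" by (simp add: n_def)
  define V where "V = unit_ball_vol (real n)"
  have V: "V > 0" by (simp add: V_def)
  define q where "q = 2 powr (n - 2 * \<beta>)"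
  have q: "q < 1"
    using \<beta> powr_less_mono[of "n - 2 * \<beta>" 0 2] by (auto simp: q_def n_def)
  define C where "C = V * 2 ^ n / (1 - q)"
  have C: "C > 0" using V q by (simp add: C_def)
  \<comment> \<open>chosen so that the low-frequency term below is half of the left-hand side \<open>(M / 2)\<^sup>2\<close>\<close>
  define \<delta> where "\<delta> = root n (1 / (8 * V\<^sup>2 * 2 ^ n))"
  have \<delta>: "\<delta> > 0" "\<delta> ^ n = 1 / (8 * V\<^sup>2 * 2 ^ n)"
    using n V by (simp_all add: \<delta>_def)
  define D where "D = sqrt (8 * V * 2 ^ n * C * \<delta> powr (n - 2 * \<beta>))"
  have D2: "D\<^sup>2 = 8 * V * 2 ^ n * C * \<delta> powr (n - 2 * \<beta>)"
    using V C by (simp add: D_def)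
  have D: "D > 0" using V C \<delta> by (simp add: D_def)
  have "(\<integral>x. norm (u x) \<partial>lborel) \<le> D * A * R powr \<beta>"
    if u: "integrable lborel u" and R: "R > 0" and A: "A \<ge> 0"
      and ae: "AE \<xi> in lborel. norm \<xi> powr \<beta> * norm (lborel_fourier u \<xi>) \<le> A"
      and half: "(\<integral>x. norm (u x) \<partial>lborel) / 2 \<le> (\<integral>x. norm (u x) * indicator (cball 0 R) x \<partial>lborel)"
    for u :: "'a \<Rightarrow> complex" and A R
  proof -
    define M where "M = (\<integral>x. norm (u x) \<partial>lborel)"
    have M: "M \<ge> 0" by (simp add: M_def)
    define L where "L = (\<integral>x. norm (u x) * indicator (cball 0 R) x \<partial>lborel)"
    define r where "r = \<delta> / R"
    have r: "r > 0" using \<delta> R by (simp add: r_def)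
    have "ennreal ((M / 2)\<^sup>2) \<le> ennreal (L\<^sup>2)"
      using half M by (intro ennreal_leI power_mono) (auto simp: M_def L_def)
    also have "\<dots> = (ennreal L)\<^sup>2" by (simp add: ennreal_power L_def)
    also have "ennreal L = (\<integral>\<^sup>+x. norm (u x) * indicator (cball 0 R) x \<partial>lborel)"
      unfolding L_def using u by (intro nn_integral_eq_integral[symmetric] integrable_real_mult_indicator) auto
    also have "(\<dots>)\<^sup>2 \<le> (\<integral>\<^sup>+\<xi>. (ennreal (norm (lborel_fourier u \<xi>)))\<^sup>2 \<partial>lborel) * emeasure lborel (cball 0 (2 * R) :: 'a set)"
      by (rule local_L1_le_fourier_L2[OF u R])
    also have "\<dots> \<le> ennreal (V * r ^ n * M\<^sup>2 + C * A\<^sup>2 * r powr (n - 2 * \<beta>)) * ennreal (V * (2 * R) ^ n)"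
      using R fourier_L2_le[OF u \<beta> r ae A]
      by (intro mult_mono) (auto simp: emeasure_cball V_def n_def C_def q_def M_def)
    also have "\<dots> = ennreal ((V * r ^ n * M\<^sup>2 + C * A\<^sup>2 * r powr (n - 2 * \<beta>)) * (V * (2 * R) ^ n))"
      using V R r C by (intro ennreal_mult[symmetric]) auto
    finally have "(M / 2)\<^sup>2 \<le> (V * r ^ n * M\<^sup>2 + C * A\<^sup>2 * r powr (n - 2 * \<beta>)) * (V * (2 * R) ^ n)"
      using V R r C by (subst (asm) ennreal_le_iff) auto
    also have "\<dots> = V\<^sup>2 * 2 ^ n * (r * R) ^ n * M\<^sup>2 + V * 2 ^ n * C * A\<^sup>2 * (R ^ n * r powr (n - 2 * \<beta>))"
      by (simp add: power_mult_distrib algebra_simps power2_eq_square)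
    also have "r * R = \<delta>" using R by (simp add: r_def)
    also have "V\<^sup>2 * 2 ^ n * \<delta> ^ n * M\<^sup>2 = M\<^sup>2 / 8" using V by (simp add: \<delta>(2))
    also have "R ^ n * r powr (n - 2 * \<beta>) = \<delta> powr (n - 2 * \<beta>) * R powr (2 * \<beta>)"
      using R \<delta> by (simp add: r_def powr_divide powr_diff powr_realpow)
    also have "R powr (2 * \<beta>) = (R powr \<beta>)\<^sup>2"
      using R by (simp add: powr_power)
    also have "M\<^sup>2 / 8 + V * 2 ^ n * C * A\<^sup>2 * (\<delta> powr (n - 2 * \<beta>) * (R powr \<beta>)\<^sup>2) = M\<^sup>2 / 8 + (D * A * R powr \<beta>)\<^sup>2 / 8"
      by (simp add: power_mult_distrib D2)
    finally have "M\<^sup>2 \<le> (D * A * R powr \<beta>)\<^sup>2"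
      by (simp add: power_divide)
    then have "M \<le> D * A * R powr \<beta>"
      by (rule power2_le_imp_le) (use D A in auto)
    then show ?thesis by (simp add: M_def)
  qed
  with D show ?thesis by (rule that)
qed

section \<open>Passage to Lebesgue measure and the inequality\<close>

lemma borel_representative:
  fixes u :: "'a::euclidean_space \<Rightarrow> complex"
  assumes "integrable lebesgue u"
  obtains v where "integrable lborel v" "AE x in lborel. u x = v x"
proof -
  have [measurable]: "u \<in> borel_measurable lebesgue" using assms by auto
  have "(\<lambda>x. Re (u x)) \<in> borel_measurable lebesgue" "(\<lambda>x. Im (u x)) \<in> borel_measurable lebesgue"
    by measurable
  from this[THEN completion_ex_borel_measurable_real] obtain a b
    where [measurable]: "a \<in> borel_measurable lborel" "b \<in> borel_measurable lborel"
      and ae: "AE x in lborel. Re (u x) = a x" "AE x in lborel. Im (u x) = b x"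
    by auto
  define v where "v x = Complex (a x) (b x)" for x
  have "v = (\<lambda>x. complex_of_real (a x) + \<i> * complex_of_real (b x))"
    by (simp add: v_def fun_eq_iff complex_eq_iff)
  then have [measurable]: "v \<in> borel_measurable lborel" by simp
  have uv: "AE x in lborel. u x = v x"
    using ae by eventually_elim (simp add: v_def complex_eq_iff)
  have "v \<in> borel_measurable lebesgue" by (rule measurable_completion) measurable
  then have "integrable lebesgue v"
    by (rule integrable_cong_AE_imp[OF assms _ AE_completion[OF uv]])
  then have "integrable lborel v" by (simp add: integrable_completion)
  with uv show ?thesis using that by blast
qed

lemma fourier_eq_lborel_fourier:
  fixes u v :: "real ^ 'n::finite \<Rightarrow> complex"
  assumes u: "integrable lebesgue u" and v: "integrable lborel v" and uv: "AE x in lborel. u x = v x"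
  shows "fourier u = lborel_fourier v"
proof
  fix \<xi> :: "real ^ 'n"
  have [measurable]: "v \<in> borel_measurable borel" "u \<in> borel_measurable lebesgue" using u v by auto
  define e where "e x = exp (- 2 * of_real pi * \<i> * of_real (\<xi> \<bullet> x))" for x
  have [measurable]: "e \<in> borel_measurable borel"
    by (intro borel_measurable_continuous_onI) (auto simp: e_def intro!: continuous_intros)
  have [measurable]: "e \<in> borel_measurable lebesgue" "v \<in> borel_measurable lebesgue"
    by (auto intro: measurable_completion)
  have "fourier u \<xi> = (\<integral>x. u x * e x \<partial>lebesgue)" by (simp add: fourier_def e_def)
  also have "\<dots> = (\<integral>x. v x * e x \<partial>lebesgue)"
    using AE_completion[OF uv] by (intro integral_cong_AE) auto
  also have "\<dots> = (\<integral>x. v x * e x \<partial>lborel)"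
    by (rule integral_completion) measurable
  finally show "fourier u \<xi> = lborel_fourier v \<xi>" by (simp add: lborel_fourier_def e_def)
qed

theorem theorem1:
  fixes \<alpha> \<beta> :: real
  assumes "\<alpha> > 0" and "\<beta> > real CARD('n) / 2"
  shows "\<exists>c::real. c > 0 \<and>
    (\<forall>u :: real ^ 'n::finite \<Rightarrow> complex. integrable lebesgue u \<longrightarrow>
      ennreal_powr (Linf_norm (\<lambda>\<xi>. of_real (norm \<xi> powr \<beta>) * fourier u \<xi>)) \<alpha> *
      ennreal_powr (L1_norm (\<lambda>x. of_real (norm x powr \<alpha>) * u x)) \<beta>
      \<ge> ennreal c * ennreal_powr (L1_norm u) (\<alpha> + \<beta>))"
proof -
  have \<alpha>: "\<alpha> > 0" by fact
  have \<beta>: "\<beta> > real DIM(real ^ 'n) / 2" using assms(2) by simp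
  obtain D where D: "D > 0" and key:
    "\<And>(u :: real ^ 'n \<Rightarrow> complex) A R. integrable lborel u \<Longrightarrow> R > 0 \<Longrightarrow> A \<ge> 0 \<Longrightarrow>
       AE \<xi> in lborel. norm \<xi> powr \<beta> * norm (lborel_fourier u \<xi>) \<le> A \<Longrightarrow>
       (\<integral>x. norm (u x) \<partial>lborel) / 2 \<le> (\<integral>x. norm (u x) * indicator (cball 0 R) x \<partial>lborel) \<Longrightarrow>
       (\<integral>x. norm (u x) \<partial>lborel) \<le> D * A * R powr \<beta>"
    using L1_le_of_concentration[OF \<beta>] by blast
  define c where "c = 1 / (D powr \<alpha> * 2 powr \<beta>)"
  have c: "c > 0" using D by (simp add: c_def)
  show ?thesis
  proof (intro exI[of _ c] conjI c allI impI)
    fix u0 :: "real ^ 'n \<Rightarrow> complex" assume u0: "integrable lebesgue u0"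
    obtain u where u: "integrable lborel u" and ae: "AE x in lborel. u0 x = u x"
      using borel_representative[OF u0] .
    have [measurable]: "u \<in> borel_measurable borel" using u by auto
    have F: "fourier u0 = lborel_fourier u" by (rule fourier_eq_lborel_fourier[OF u0 u ae])
    define A where "A = Linf_norm (\<lambda>\<xi>. of_real (norm \<xi> powr \<beta>) * fourier u0 \<xi>)"
    define B where "B = L1_norm (\<lambda>x. of_real (norm x powr \<alpha>) * u0 x)"
    define M where "M = (\<integral>x. norm (u x) \<partial>lborel)"
    have M0: "M \<ge> 0" by (simp add: M_def)
    have L1: "L1_norm u0 = ennreal M"
    proof -
      have "L1_norm u0 = (\<integral>\<^sup>+x. norm (u x) \<partial>lborel)"
        unfolding L1_norm_def nn_integral_completion using ae by (intro nn_integral_cong_AE) auto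
      also have "\<dots> = ennreal M"
        unfolding M_def using u by (intro nn_integral_eq_integral) auto
      finally show ?thesis .
    qed
    have B_eq: "B = (\<integral>\<^sup>+x. ennreal (norm x powr \<alpha> * norm (u x)) \<partial>lborel)"
      unfolding B_def L1_norm_def nn_integral_completion
      using ae by (intro nn_integral_cong_AE) (auto simp: norm_mult)
    have "AE \<xi> in lebesgue. ennreal (norm (of_real (norm \<xi> powr \<beta>) * fourier u0 \<xi>)) \<le> A"
      unfolding A_def Linf_norm_def by (rule esssup_AE)
    then have A_ae: "AE \<xi> in lborel. ennreal (norm \<xi> powr \<beta> * norm (lborel_fourier u \<xi>)) \<le> A"
      by (simp add: AE_completion_iff norm_mult F)
    have nz: "AE x in lborel. (x::real^'n) \<noteq> 0" by (rule AE_lborel_singleton)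
    have main: "ennreal c * ennreal_powr (ennreal M) (\<alpha> + \<beta>) \<le> ennreal_powr A \<alpha> * ennreal_powr B \<beta>"
    proof (cases "M = 0")
      case True
      then show ?thesis by (simp add: ennreal_powr_def)
    next
      case False
      then have M: "M > 0" using M0 by simp
      have u_nz: "\<not> (AE x in lborel. u x = 0)"
      proof
        assume "AE x in lborel. u x = 0"
        then have "M = (\<integral>(x::real^'n). 0 \<partial>lborel)"
          unfolding M_def by (intro integral_cong_AE) auto
        with False show False by simp
      qed
      have A_pos: "A > 0"
      proof (rule ccontr)
        assume "\<not> A > 0"
        then have "A = 0" by simp
        have "AE \<xi> in lborel. lborel_fourier u \<xi> = 0"
          using A_ae nz
        proof eventually_elim
          case (elim \<xi>)
          then have "norm \<xi> powr \<beta> * norm (lborel_fourier u \<xi>) \<le> 0"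
            using \<open>A = 0\<close> by (simp add: ennreal_eq_0_iff)
          with elim(2) show ?case by (simp add: mult_le_0_iff)
        qed
        with lborel_fourier_injective[OF u] u_nz show False by blast
      qed
      have B_pos: "B > 0"
      proof (rule ccontr)
        assume "\<not> B > 0"
        then have "(\<integral>\<^sup>+x. ennreal (norm x powr \<alpha> * norm (u x)) \<partial>lborel) = 0" by (simp add: B_eq)
        then have "AE x in lborel. ennreal (norm x powr \<alpha> * norm (u x)) = 0"
          by (subst (asm) nn_integral_0_iff_AE) auto
        then have "AE x in lborel. u x = 0"
          using nz
        proof eventually_elim
          case (elim x)
          then have "norm x powr \<alpha> * norm (u x) \<le> 0"
            by (simp add: ennreal_eq_0_iff)
          with elim(2) show ?case by (simp add: mult_le_0_iff)
        qed
        with u_nz show False by blast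
      qed
      \<comment> \<open>an infinite factor makes the product infinite, since the other factor is positive\<close>
      have pos: "ennreal_powr t p > 0" if "t > 0" for t p
        using that by (cases t) (auto simp: ennreal_powr_def)
      show ?thesis
      proof (cases "A = \<infinity> \<or> B = \<infinity>")
        case True
        then have "ennreal_powr A \<alpha> * ennreal_powr B \<beta> = \<infinity>"
          using pos[OF A_pos, of \<alpha>] pos[OF B_pos, of \<beta>]
          by (auto simp: ennreal_powr_def ennreal_mult_eq_top_iff split: if_splits)
        then show ?thesis by simp
      next
        case False
        then obtain a b where ab: "A = ennreal a" "a \<ge> 0" "B = ennreal b" "b \<ge> 0"
          by (cases A; cases B) auto
        with A_pos B_pos have ab0: "a > 0" "b > 0" by auto
        have A_ae': "AE \<xi> in lborel. norm \<xi> powr \<beta> * norm (lborel_fourier u \<xi>) \<le> a"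
          using A_ae ab by simp
        have Bb: "(\<integral>\<^sup>+x. ennreal (norm x powr \<alpha> * norm (u x)) \<partial>lborel) = ennreal b"
          using B_eq ab by simp
        have ib: "integrable lborel (\<lambda>x. norm x powr \<alpha> * norm (u x))"
          by (intro integrableI_nonneg) (auto simp: Bb)
        have b: "(\<integral>x. norm x powr \<alpha> * norm (u x) \<partial>lborel) = b"
          using nn_integral_eq_integral[OF ib] Bb ab by simp
        define R where "R = (2 * b / M) powr (1 / \<alpha>)"
        have R: "R > 0" using ab0 M by (simp add: R_def)
        have "M / 2 \<le> (\<integral>x. norm (u x) * indicator (cball 0 R) x \<partial>lborel)"
          unfolding R_def by (rule concentration_radius[OF u \<alpha> ib b ab0(2) M_def[symmetric] M])
        then have "M \<le> D * a * R powr \<beta>"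
          using key[OF u R ab(2) A_ae'] by (simp add: M_def)
        then have "M powr \<alpha> \<le> (D * a * R powr \<beta>) powr \<alpha>"
          using M \<alpha> by (intro powr_mono2) auto
        also have "\<dots> = D powr \<alpha> * a powr \<alpha> * (R powr \<beta>) powr \<alpha>"
          using D ab0 by (simp add: powr_mult)
        also have "(R powr \<beta>) powr \<alpha> = (2 * b / M) powr \<beta>"
          using \<alpha> by (simp add: R_def powr_powr)
        also have "\<dots> = 2 powr \<beta> * b powr \<beta> / M powr \<beta>"
          using ab0 M by (simp add: powr_mult powr_divide)
        finally have "M powr \<alpha> * M powr \<beta> \<le> D powr \<alpha> * 2 powr \<beta> * (a powr \<alpha> * b powr \<beta>)"
          using M by (simp add: field_simps)
        then have "c * M powr (\<alpha> + \<beta>) \<le> a powr \<alpha> * b powr \<beta>"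
          using D by (simp add: c_def powr_add field_simps)
        then show ?thesis
          using ab c M0 by (simp add: ennreal_powr_def ennreal_mult[symmetric] ennreal_leI)
      qed
    qed
    show "ennreal c * ennreal_powr (L1_norm u0) (\<alpha> + \<beta>) \<le>
        ennreal_powr (Linf_norm (\<lambda>\<xi>. of_real (norm \<xi> powr \<beta>) * fourier u0 \<xi>)) \<alpha> *
        ennreal_powr (L1_norm (\<lambda>x. of_real (norm x powr \<alpha>) * u0 x)) \<beta>"
      using main unfolding L1 A_def B_def .
  qed
qed

end
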